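(* The distinct eigenvalues of the $k$-uniform hyperpath $P_m^{(k)}$ are the different numbers of $$\Big(2\cos\frac{\pi}{j+2}t\Big)^{\frac{2}{k}}e^{\mathbf{i}\frac{2\pi}{k}\theta}$$ for all $j\in[m]$, $t\in[j+1]$ and $\theta\in[k]$, where $\mathbf{i}^2=-1$.
   Context: For a positive integer $n$, $[n]=\{1,\ldots,n\}$. A hypergraph is $k$-uniform if each of its edges contains exactly $k$ distinct vertices; when $k=2$ it is a graph. $P_m$ denotes the path of length $m$ ($m$ edges, $m+1$ vertices). The $k$-uniform hyperpath $P_m^{(k)}$ is the $k$-uniform hypergraph obtained by adding $k-2$ vertices of degree one to each edge of $P_m$. The eigenvalues of a $k$-uniform hypergraph $H$ with vertex set $V(H)$ and edge set $E(H)$ are the eigenvalues of its adjacency tensor: $\lambda\in\mathbb{C}$ is an eigenvalue of $H$ if there is a nonzero complex vector $x=(x_i)_{i\in V(H)}$ such that, for every $i\in V(H)$, $$\sum_{e\in E(H),\, i\in e}\ \prod_{l\in e\setminus\{i\}}x_l=\lambda x_i^{k-1}.$$ For a real number $c$, $c^{2/k}$ is a number whose $k$-th power is $c^2$; since $\theta$ runs over all of $[k]$, the choice of this root does not affect the resulting set of numbers.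
   Formalization: Proved for m ≥ 2 and k ≥ 3: for m = 1, k ≥ 3 the list omits the eigenvalue 0, and for k = 2, m ≥ 2 it contains numbers that are not eigenvalues of the path (e.g. 1 for P_2); only the single-edge graph (m = 1, k = 2), where the claim holds, is also excluded. *)

theory Defs
  imports Complex_Main
begin

text \<open>A hypergraph is given by its vertex set and its edge set.\<close>

type_synonym 'a hypergraph = "'a set \<times> 'a set set"

definition uniform_hypergraph :: "nat \<Rightarrow> 'a hypergraph \<Rightarrow> bool" where
  "uniform_hypergraph k H \<longleftrightarrow>
     finite (fst H) \<and> (\<forall>e\<in>snd H. e \<subseteq> fst H \<and> card e = k)"

text \<open>
  The eigenvalue equations of the adjacency tensor of a \<open>k\<close>-uniform hypergraph.
  Only the values of \<open>x\<close> on the vertex set matter, so \<open>x\<close> being nonzero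
  is required there.
\<close>

definition hypergraph_eigenvalue :: "nat \<Rightarrow> 'a hypergraph \<Rightarrow> complex \<Rightarrow> bool" where
  "hypergraph_eigenvalue k H \<mu> \<longleftrightarrow>
     (\<exists>x :: 'a \<Rightarrow> complex.
        (\<exists>i\<in>fst H. x i \<noteq> 0) \<and>
        (\<forall>i\<in>fst H. (\<Sum>e | e \<in> snd H \<and> i \<in> e. \<Prod>l\<in>e - {i}. x l) = \<mu> * x i ^ (k - 1)))"

definition path_graph :: "nat \<Rightarrow> nat hypergraph" where
  "path_graph m = ({0..m}, {{i, Suc i} | i. i < m})"

text \<open>
  The vertices added to an edge \<open>e\<close> of a graph are the \<open>Inr (e, a)\<close> with
  \<open>a \<in> {1..k - 2}\<close>; each of them lies in the enlarged edge of \<open>e\<close> only.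
\<close>

definition enlarge_edge :: "nat \<Rightarrow> 'a set \<Rightarrow> ('a + 'a set \<times> nat) set" where
  "enlarge_edge k e = Inl ` e \<union> Inr ` ({e} \<times> {1..k - 2})"

definition power_hypergraph :: "nat \<Rightarrow> 'a hypergraph \<Rightarrow> ('a + 'a set \<times> nat) hypergraph" where
  "power_hypergraph k G =
     (Inl ` fst G \<union> Inr ` (snd G \<times> {1..k - 2}), enlarge_edge k ` snd G)"

definition hyperpath :: "nat \<Rightarrow> nat \<Rightarrow> (nat + nat set \<times> nat) hypergraph" where
  "hyperpath m k = power_hypergraph k (path_graph m)"

lemma uniform_hypergraph_hyperpath:
  assumes "k \<ge> 2"
  shows "uniform_hypergraph k (hyperpath m k)"
proof -
  have fin: "finite {{i, Suc i} | i. i < m}"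
    by simp
  have card: "card (enlarge_edge k {i, Suc i}) = k" for i
  proof -
    have "card (enlarge_edge k {i, Suc i})
        = card (Inl ` {i, Suc i} :: (nat + nat set \<times> nat) set)
        + card (Inr ` ({{i, Suc i}} \<times> {1..k - 2}) :: (nat + nat set \<times> nat) set)"
      unfolding enlarge_edge_def by (rule card_Un_disjoint) auto
    also have "\<dots> = k"
      using assms by (simp add: card_image card_cartesian_product)
    finally show ?thesis .
  qed
  show ?thesis
    unfolding uniform_hypergraph_def hyperpath_def power_hypergraph_def path_graph_def
    using card fin by (auto simp: enlarge_edge_def)
qed

end

theory Submission
  imports Defs "HOL-Analysis.Complex_Transcendental"
begin

text \<open>
  Let \<open>x\<close> satisfy the eigenvalue equations of the hyperpath for \<open>\<mu> \<noteq> 0\<close>, and write \<open>p\<^sub>e\<close> for the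
  product of \<open>x\<close> over the whole edge that enlarges \<open>e\<close>. Multiplying the equation at \<open>v\<close> by \<open>x\<^sub>v\<close>
  turns it into \<open>\<Sum>\<^sub>e p\<^sub>e = \<mu> x\<^sub>v\<^sup>k\<close>. At an added vertex this reads \<open>p\<^sub>e = \<mu> x\<^sub>v\<^sup>k\<close>, so the added vertices
  can be eliminated from \<open>p\<^sub>e\<^sup>k\<close>. With \<open>X\<^sub>u = x\<^sub>u\<^sup>k\<close>, what remains is a system on the graph alone:
  \<open>\<mu> X\<^sub>u\<close> is the sum of the \<open>p\<^sub>e\<close> at \<open>u\<close>, and \<open>p\<^sub>e\<^sup>2 \<mu>^(k - 2) = X\<^sub>u X\<^sub>v\<close> for each edge \<open>e = uv\<close> with
  \<open>p\<^sub>e \<noteq> 0\<close> (lemma \<open>power_hypergraph_eigenvalueD\<close>). Conversely, a nonzero solution whose second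
  equation holds at every edge comes from an eigenvector, because \<open>k \<ge> 3\<close> leaves at least one added
  vertex per edge, with which the phase of the product can be corrected
  (lemma \<open>power_hypergraph_eigenvalueI\<close>).

  On a path, take a maximal run of \<open>j\<close> consecutive edges with \<open>p\<^sub>e \<noteq> 0\<close>; the edges that vanish cut it
  off from the rest of the path, which is why shorter paths contribute to the spectrum.
  If \<open>c\<^sup>2 = \<mu>\<^sup>k\<close>, then the system is solved by \<open>X\<^sub>n\<close> proportional to \<open>w\<^sub>n\<^sup>2\<close> and \<open>p\<^sub>n\<close> proportional to
  \<open>w\<^sub>n w\<^sub>n\<^sub>+\<^sub>1\<close>, where \<open>w\<close> obeys the eigenvector recursion \<open>w\<^sub>n\<^sub>-\<^sub>1 + w\<^sub>n\<^sub>+\<^sub>1 = c w\<^sub>n\<close> of the path, that is,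
  \<open>w\<^sub>n\<close> is the characteristic polynomial of the path on \<open>n\<close> vertices evaluated at \<open>c\<close>. The run ends
  exactly when \<open>w\<close> vanishes, so \<open>c\<close> is an eigenvalue \<open>2 cos (\<pi> t / (j + 2))\<close> of the path with \<open>j\<close>
  edges. In the other direction, the sine eigenvector of that path, extended by zero to all of the
  path with \<open>m\<close> edges, solves the system.

  The value \<open>0\<close> is an eigenvalue since \<open>k \<ge> 3\<close>, and it is of the stated form by \<open>j = t = 2\<close>. Finally,
  the numbers in the theorem are just all \<open>k\<close>-th roots of the numbers \<open>(2 cos (\<pi> t / (j + 2)))\<^sup>2\<close>.
\<close>

section \<open>Eigenvalue equations in terms of edge products\<close>

lemma sum_edge_products:
  fixes x :: "'a \<Rightarrow> complex"
  assumes "\<And>e. e \<in> E \<Longrightarrow> finite e"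
  shows "(\<Sum>e | e \<in> E \<and> v \<in> e. \<Prod>l\<in>e - {v}. x l) * x v = (\<Sum>e | e \<in> E \<and> v \<in> e. \<Prod>l\<in>e. x l)"
  unfolding sum_distrib_right
  by (rule sum.cong) (use assms in \<open>auto simp: prod.remove mult.commute\<close>)

text \<open>
  Multiplication by \<open>x v\<close> loses information only where \<open>x v = 0\<close>, so there the original equation has
  to be supplied; the premise \<open>zero\<close> does this edge by edge.
\<close>

lemma hypergraph_eigenvalueI:
  fixes x :: "'a \<Rightarrow> complex"
  assumes H: "uniform_hypergraph k H" and k: "k \<ge> 2"
    and nz: "\<exists>v\<in>fst H. x v \<noteq> 0"
    and eq: "\<And>v. v \<in> fst H \<Longrightarrow> (\<Sum>e | e \<in> snd H \<and> v \<in> e. \<Prod>l\<in>e. x l) = \<mu> * x v ^ k"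
    and zero: "\<And>v e. e \<in> snd H \<Longrightarrow> v \<in> e \<Longrightarrow> x v = 0 \<Longrightarrow> (\<Prod>l\<in>e - {v}. x l) = 0"
  shows "hypergraph_eigenvalue k H \<mu>"
proof -
  have fin: "finite e" if "e \<in> snd H" for e
    using H that unfolding uniform_hypergraph_def by (meson finite_subset)
  have "(\<Sum>e | e \<in> snd H \<and> v \<in> e. \<Prod>l\<in>e - {v}. x l) = \<mu> * x v ^ (k - 1)" if v: "v \<in> fst H" for v
  proof (cases "x v = 0")
    case True
    then show ?thesis using zero[of _ v] k by (simp add: sum.neutral)
  next
    case False
    have "(\<Sum>e | e \<in> snd H \<and> v \<in> e. \<Prod>l\<in>e - {v}. x l) * x v = \<mu> * x v ^ (k - 1) * x v"
      using sum_edge_products[OF fin, of "snd H" x v] eq[OF v]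
        power_minus_mult[of k "x v"] k
      by (simp add: mult.assoc)
    then show ?thesis using False by simp
  qed
  then show ?thesis using nz unfolding hypergraph_eigenvalue_def by blast
qed

section \<open>Edges of a power hypergraph\<close>

lemma prod_enlarge_edge:
  fixes x :: "'a + 'a set \<times> nat \<Rightarrow> complex"
  assumes "finite e"
  shows "(\<Prod>l\<in>enlarge_edge k e. x l) = (\<Prod>u\<in>e. x (Inl u)) * (\<Prod>a\<in>{1..k - 2}. x (Inr (e, a)))"
proof -
  have "(\<Prod>l\<in>enlarge_edge k e. x l) = (\<Prod>l\<in>Inl ` e. x l) * (\<Prod>l\<in>Inr ` ({e} \<times> {1..k - 2}). x l)"
    unfolding enlarge_edge_def using assms by (intro prod.union_disjoint) auto
  moreover have "Inr ` ({e} \<times> {1..k - 2}) = (\<lambda>a. Inr (e, a) :: 'a + 'a set \<times> nat) ` {1..k - 2}"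
    by auto
  moreover have "(\<Prod>l\<in>(\<lambda>a. Inr (e, a)) ` {1..k - 2}. x l) = (\<Prod>a\<in>{1..k - 2}. x (Inr (e, a)))"
    by (subst prod.reindex) (auto simp: inj_on_def)
  moreover have "(\<Prod>l\<in>Inl ` e. x l) = (\<Prod>u\<in>e. x (Inl u))"
    by (subst prod.reindex) auto
  ultimately show ?thesis by simp
qed

lemma inj_enlarge_edge: "inj (enlarge_edge k)"
proof (rule injI)
  fix e f :: "'a set"
  assume "enlarge_edge k e = enlarge_edge k f"
  \<comment> \<open>The old vertices of an enlarged edge determine it.\<close>
  moreover have "Inl -` enlarge_edge k g = g" for g :: "'a set"
    by (auto simp: enlarge_edge_def)
  ultimately show "e = f" by metis
qed

lemma card_enlarge_edge:
  assumes "card e = 2" "k \<ge> 2"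
  shows "card (enlarge_edge k e) = k"
proof -
  have "finite e" using assms by (metis card.infinite zero_neq_numeral)
  have "card (enlarge_edge k e)
      = card (Inl ` e :: ('a + 'a set \<times> nat) set) + card (Inr ` ({e} \<times> {1..k - 2}) :: ('a + 'a set \<times> nat) set)"
    unfolding enlarge_edge_def by (rule card_Un_disjoint) (use \<open>finite e\<close> in auto)
  then show ?thesis using assms by (simp add: card_image card_cartesian_product)
qed

lemma uniform_power_hypergraph:
  assumes G: "uniform_hypergraph 2 G" and k: "k \<ge> 2"
  shows "uniform_hypergraph k (power_hypergraph k G)"
proof -
  have "snd G \<subseteq> Pow (fst G)" "finite (fst G)" using G by (auto simp: uniform_hypergraph_def)
  then have "finite (snd G)" by (meson finite_Pow_iff finite_subset)
  moreover have "card (enlarge_edge k e) = k" if "e \<in> snd G" for e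
    using G k that by (intro card_enlarge_edge) (auto simp: uniform_hypergraph_def)
  ultimately show ?thesis
    using G by (fastforce simp: uniform_hypergraph_def power_hypergraph_def enlarge_edge_def)
qed

lemma edge_sum_old_vertex:
  "(\<Sum>f | f \<in> snd (power_hypergraph k G) \<and> Inl u \<in> f. F f)
     = (\<Sum>e | e \<in> snd G \<and> u \<in> e. F (enlarge_edge k e))"
proof -
  have "{f. f \<in> snd (power_hypergraph k G) \<and> Inl u \<in> f} = enlarge_edge k ` {e. e \<in> snd G \<and> u \<in> e}"
    by (auto simp: power_hypergraph_def enlarge_edge_def)
  then show ?thesis
    by (simp add: sum.reindex inj_on_subset[OF inj_enlarge_edge])
qed

lemma edge_sum_new_vertex:
  assumes "e \<in> snd G" "a \<in> {1..k - 2}"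
  shows "(\<Sum>f | f \<in> snd (power_hypergraph k G) \<and> Inr (e, a) \<in> f. F f) = F (enlarge_edge k e)"
proof -
  have "{f. f \<in> snd (power_hypergraph k G) \<and> Inr (e, a) \<in> f} = {enlarge_edge k e}"
    using assms by (auto simp: power_hypergraph_def enlarge_edge_def)
  then show ?thesis by simp
qed

section \<open>Reduction of a power hypergraph to its graph\<close>

lemma power_extract_square:
  fixes a :: "'a::monoid_mult"
  assumes "k \<ge> 2"
  shows "a ^ k = a\<^sup>2 * a ^ (k - 2)"
  using assms by (metis le_add_diff_inverse power_add)

text \<open>
  The witnesses are \<open>X u = x\<^sub>u\<^sup>k\<close> and the edge products \<open>p\<close> of an eigenvector \<open>x\<close>. Some \<open>p e\<close> is
  nonzero, since otherwise the multiplied equations would force \<open>x = 0\<close>. The relation for \<open>p e\<close>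
  comes from \<open>(p e)\<^sup>k\<close>, in which each of the \<open>k - 2\<close> added vertices contributes a factor \<open>p e / \<mu>\<close>;
  cancelling these factors is what needs \<open>p e \<noteq> 0\<close>.
\<close>

lemma power_hypergraph_eigenvalueD:
  assumes G: "uniform_hypergraph 2 G" and k: "k \<ge> 2" and \<mu>: "\<mu> \<noteq> 0"
    and ev: "hypergraph_eigenvalue k (power_hypergraph k G) \<mu>"
  obtains X p where "\<exists>e\<in>snd G. p e \<noteq> 0"
    and "\<And>u. u \<in> fst G \<Longrightarrow> (\<Sum>e | e \<in> snd G \<and> u \<in> e. p e) = \<mu> * X u"
    and "\<And>e. e \<in> snd G \<Longrightarrow> p e \<noteq> 0 \<Longrightarrow> (p e)\<^sup>2 * \<mu> ^ (k - 2) = (\<Prod>u\<in>e. X u)"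
proof -
  let ?H = "power_hypergraph k G"
  obtain x where nz: "\<exists>v\<in>fst ?H. x v \<noteq> 0"
    and eq: "\<And>v. v \<in> fst ?H \<Longrightarrow> (\<Sum>e | e \<in> snd ?H \<and> v \<in> e. \<Prod>l\<in>e - {v}. x l) = \<mu> * x v ^ (k - 1)"
    using ev unfolding hypergraph_eigenvalue_def by blast
  have fin: "finite f" if "f \<in> snd ?H" for f
    using uniform_power_hypergraph[OF G k] that unfolding uniform_hypergraph_def by (meson finite_subset)
  have eq': "(\<Sum>e | e \<in> snd ?H \<and> v \<in> e. \<Prod>l\<in>e. x l) = \<mu> * x v ^ k" if "v \<in> fst ?H" for v
    using sum_edge_products[OF fin, of "snd ?H" x v] eq[OF that]
      power_minus_mult[of k "x v"] k
    by (simp add: mult.assoc)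
  define p where "p e = (\<Prod>l\<in>enlarge_edge k e. x l)" for e
  define X where "X u = x (Inl u) ^ k" for u
  have old: "(\<Sum>e | e \<in> snd G \<and> u \<in> e. p e) = \<mu> * X u" if "u \<in> fst G" for u
  proof -
    have "Inl u \<in> fst ?H" using that by (simp add: power_hypergraph_def)
    from eq'[OF this] show ?thesis by (simp add: edge_sum_old_vertex p_def X_def)
  qed
  have new: "p e = \<mu> * x (Inr (e, a)) ^ k" if "e \<in> snd G" "a \<in> {1..k - 2}" for e a
  proof -
    have "Inr (e, a) \<in> fst ?H" using that by (simp add: power_hypergraph_def)
    from eq'[OF this] show ?thesis by (simp add: edge_sum_new_vertex[OF that] p_def)
  qed
  have "\<exists>e\<in>snd G. p e \<noteq> 0"
  proof (rule ccontr)
    assume "\<not> ?thesis"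
    then have p0: "p e = 0" if "e \<in> snd G" for e using that by blast
    have "x (Inl u) = 0" if "u \<in> fst G" for u
      using old[OF that] p0 \<mu> k by (simp add: X_def sum.neutral)
    moreover have "x (Inr (e, a)) = 0" if "e \<in> snd G" "a \<in> {1..k - 2}" for e a
      using new[OF that] p0[OF that(1)] \<mu> k by simp
    ultimately show False using nz by (force simp: power_hypergraph_def)
  qed
  moreover have "(p e)\<^sup>2 * \<mu> ^ (k - 2) = (\<Prod>u\<in>e. X u)" if e: "e \<in> snd G" and pe: "p e \<noteq> 0" for e
  proof -
    have "finite e" using G e unfolding uniform_hypergraph_def by (meson finite_subset)
    have "p e ^ k * \<mu> ^ (k - 2)
        = (\<Prod>u\<in>e. X u) * ((\<Prod>a\<in>{1..k - 2}. x (Inr (e, a)) ^ k) * \<mu> ^ (k - 2))"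
      by (simp add: p_def prod_enlarge_edge[OF \<open>finite e\<close>] X_def power_mult_distrib prod_power_distrib)
    also have "(\<Prod>a\<in>{1..k - 2}. x (Inr (e, a)) ^ k) * \<mu> ^ (k - 2)
        = (\<Prod>a\<in>{1..k - 2}. \<mu> * x (Inr (e, a)) ^ k)"
      by (simp add: prod.distrib)
    also have "\<dots> = (\<Prod>a\<in>{1..k - 2}. p e)"
      by (rule prod.cong) (use new[OF e] in auto)
    also have "\<dots> = p e ^ (k - 2)" by simp
    finally have "p e ^ k * \<mu> ^ (k - 2) = (\<Prod>u\<in>e. X u) * p e ^ (k - 2)" .
    moreover have "p e ^ k = (p e)\<^sup>2 * p e ^ (k - 2)" using k by (rule power_extract_square)
    ultimately show ?thesis using pe by simp
  qed
  ultimately show ?thesis using that old by blast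
qed

text \<open>
  Any \<open>k\<close>-th roots of the \<open>X u\<close> and of \<open>p e / \<mu>\<close> have the right \<open>k\<close>-th powers, but their product over
  an enlarged edge equals \<open>p e\<close> only up to a \<open>k\<close>-th root of unity. The value at the first added
  vertex is therefore defined by the product condition instead, and the edge relation shows that
  it is a \<open>k\<close>-th root of \<open>p e / \<mu>\<close> as well. If \<open>p e = 0\<close>, the relation makes \<open>x\<close> vanish at an end point of \<open>e\<close>
  as well as at the added vertices, so each product with one vertex of the edge left out is zero.
\<close>

lemma power_hypergraph_eigenvalueI:
  fixes X :: "'a \<Rightarrow> complex"
  assumes G: "uniform_hypergraph 2 G" and k: "k \<ge> 3" and \<mu>: "\<mu> \<noteq> 0"
    and nz: "\<exists>u\<in>fst G. X u \<noteq> 0"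
    and vertex: "\<And>u. u \<in> fst G \<Longrightarrow> (\<Sum>e | e \<in> snd G \<and> u \<in> e. p e) = \<mu> * X u"
    and edge: "\<And>e. e \<in> snd G \<Longrightarrow> (p e)\<^sup>2 * \<mu> ^ (k - 2) = (\<Prod>u\<in>e. X u)"
  shows "hypergraph_eigenvalue k (power_hypergraph k G) \<mu>"
proof -
  let ?H = "power_hypergraph k G"
  have H: "uniform_hypergraph k ?H" using uniform_power_hypergraph[OF G] k by simp
  have k0: "k \<noteq> 0" using k by simp
  have fin: "finite e" if "e \<in> snd G" for e
    using G that unfolding uniform_hypergraph_def by (meson finite_subset)
  have "\<exists>y. y ^ k = z" for z :: complex
    using exists_complex_root[OF k0] by metis
  then obtain r :: "complex \<Rightarrow> complex" where r: "\<And>z. r z ^ k = z" by metis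
  have r0: "r z = 0 \<longleftrightarrow> z = 0" for z using r[of z] k0 by (metis power_eq_0_iff not_gr0)
  \<comment> \<open>Division by zero makes \<open>g e = 0\<close> when \<open>p e = 0\<close>, as desired.\<close>
  define g where "g e = p e / ((\<Prod>u\<in>e. r (X u)) * r (p e / \<mu>) ^ (k - 3))" for e
  define x where "x v = (case v of Inl u \<Rightarrow> r (X u)
      | Inr (e, a) \<Rightarrow> if a = 1 then g e else r (p e / \<mu>))" for v :: "'a + 'a set \<times> nat"
  have pX: "p e = 0 \<longleftrightarrow> (\<exists>u\<in>e. X u = 0)" if "e \<in> snd G" for e
    using edge[OF that] \<mu> fin[OF that] by (metis mult_eq_0_iff power_eq_0_iff prod_zero_iff zero_less_numeral)
  have set: "{1..k - 2} = insert 1 {2..k - 2}" using k by auto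
  have prod: "(\<Prod>l\<in>enlarge_edge k e. x l) = p e" if e: "e \<in> snd G" for e
  proof -
    have "(\<Prod>a\<in>{1..k - 2}. x (Inr (e, a))) = g e * (\<Prod>a\<in>{2..k - 2}. r (p e / \<mu>))"
      unfolding set by (subst prod.insert) (auto simp: x_def intro!: prod.cong)
    also have "\<dots> = g e * r (p e / \<mu>) ^ (k - 3)"
      using k by (simp add: numeral_eq_Suc)
    finally have "(\<Prod>l\<in>enlarge_edge k e. x l) = (\<Prod>u\<in>e. r (X u)) * (g e * r (p e / \<mu>) ^ (k - 3))"
      by (simp add: prod_enlarge_edge[OF fin[OF e]] x_def)
    also have "\<dots> = p e"
      using pX[OF e] \<mu> fin[OF e] by (cases "p e = 0") (auto simp: g_def r0)
    finally show ?thesis .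
  qed
  have g: "g e ^ k = p e / \<mu>" if e: "e \<in> snd G" for e
  proof (cases "p e = 0")
    case True
    then show ?thesis using k0 by (simp add: g_def)
  next
    case False
    have "k - 2 = Suc (k - 3)" "k = (k - 3) + 3" using k by auto
    then have *: "\<mu> ^ (k - 2) = \<mu> * \<mu> ^ (k - 3)" "p e ^ k = p e ^ (k - 3) * p e ^ 3"
      by (metis power_Suc, metis power_add)
    have "g e ^ k = p e ^ k / ((\<Prod>u\<in>e. X u) * (p e / \<mu>) ^ (k - 3))"
      unfolding g_def power_divide power_mult_distrib
      by (simp add: r prod_power_distrib power_commutes flip: power_mult)
         (simp add: mult.commute[of _ k] power_mult r power_divide)
    also have "\<dots> = p e / \<mu>"
      unfolding edge[OF e, symmetric] *
      using False \<mu> by (simp add: power_divide divide_simps) (simp add: power2_eq_square power3_eq_cube)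
    finally show ?thesis .
  qed
  have inH: "v \<in> fst ?H \<Longrightarrow> (\<exists>u\<in>fst G. v = Inl u) \<or> (\<exists>e\<in>snd G. \<exists>a\<in>{1..k-2}. v = Inr (e, a))" for v
    by (auto simp: power_hypergraph_def)
  show ?thesis
  proof (rule hypergraph_eigenvalueI[OF H])
    show "k \<ge> 2" using k by simp
    show "\<exists>v\<in>fst ?H. x v \<noteq> 0"
      using nz r0 by (force simp: power_hypergraph_def x_def)
  next
    fix v assume "v \<in> fst ?H"
    then consider u where "u \<in> fst G" "v = Inl u"
      | e a where "e \<in> snd G" "a \<in> {1..k-2}" "v = Inr (e, a)" using inH by blast
    then show "(\<Sum>e | e \<in> snd ?H \<and> v \<in> e. \<Prod>l\<in>e. x l) = \<mu> * x v ^ k"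
    proof cases
      case 1
      have "(\<Sum>e | e \<in> snd G \<and> u \<in> e. \<Prod>l\<in>enlarge_edge k e. x l) = \<mu> * X u"
        unfolding vertex[OF 1(1), symmetric] by (rule sum.cong) (auto simp: prod)
      then show ?thesis by (simp add: 1(2) edge_sum_old_vertex) (simp add: x_def r)
    next
      case 2
      then show ?thesis
        using 2 \<mu> by (simp add: edge_sum_new_vertex[OF 2(1,2)] prod) (simp add: x_def r g)
    qed
  next
    fix v f assume f: "f \<in> snd ?H" and v: "v \<in> f" and x0: "x v = 0"
    then obtain e where e: "e \<in> snd G" "f = enlarge_edge k e" by (auto simp: power_hypergraph_def)
    have ff: "finite f" using fin[OF e(1)] e(2) by (simp add: enlarge_edge_def)
    then have "p e = 0" using prod[OF e(1)] v x0 unfolding e(2)[symmetric] by (metis prod_zero)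
    then obtain u where u: "u \<in> e" "X u = 0" using pX[OF e(1)] by blast
    have "Inl u \<in> f" "x (Inl u) = 0" using u r0 by (auto simp: e(2) enlarge_edge_def x_def)
    moreover have "Inr (e, 1) \<in> f" using k by (auto simp: e(2) enlarge_edge_def)
    moreover have "x (Inr (e, 1)) = 0" using \<open>p e = 0\<close> by (simp add: x_def g_def)
    ultimately have "\<exists>l\<in>f - {v}. x l = 0" by (cases "v = Inl u") auto
    then show "(\<Prod>l\<in>f - {v}. x l) = 0" using ff by (simp add: prod_zero)
  qed
qed

section \<open>The characteristic polynomial of a path\<close>

text \<open>
  The characteristic polynomial of the adjacency matrix of the path on \<open>n\<close> vertices, evaluated at
  \<open>c\<close>; equivalently \<open>U\<^sub>n(c / 2)\<close> for the Chebyshev polynomials \<open>U\<^sub>n\<close> of the second kind.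
\<close>

fun path_charpoly :: "complex \<Rightarrow> nat \<Rightarrow> complex" where
  "path_charpoly c 0 = 1"
| "path_charpoly c (Suc 0) = c"
| "path_charpoly c (Suc (Suc n)) = c * path_charpoly c (Suc n) - path_charpoly c n"

text \<open>
  The recursion has characteristic equation \<open>\<lambda>\<^sup>2 - c \<lambda> + 1 = 0\<close>, whose roots are mutually inverse
  with sum \<open>c\<close>; this is the closed form for distinct roots.
\<close>

lemma path_charpoly_sum_inverse:
  assumes "z * y = 1"
  shows "(z - y) * path_charpoly (z + y) n = z ^ Suc n - y ^ Suc n"
proof (induction "z + y" n rule: path_charpoly.induct)
  case 1
  then show ?case by simp
next
  case 2
  then show ?case by (simp add: algebra_simps)
next
  case (3 n)
  have "(z - y) * path_charpoly (z + y) (Suc (Suc n))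
      = (z + y) * ((z - y) * path_charpoly (z + y) (Suc n)) - (z - y) * path_charpoly (z + y) n"
    by (simp add: algebra_simps)
  also have "\<dots> = (z + y) * (z ^ Suc (Suc n) - y ^ Suc (Suc n)) - (z ^ Suc n - y ^ Suc n)"
    using 3 by simp
  also have "\<dots> = z ^ Suc (Suc (Suc n)) - y ^ Suc (Suc (Suc n)) + (z * y - 1) * (z ^ Suc n - y ^ Suc n)"
    by (simp add: algebra_simps)
  finally show ?case using assms by simp
qed

text \<open>
  The closed form for a double root, needed to exclude \<open>c = \<plusminus>2\<close> as a zero.
\<close>

lemma path_charpoly_double:
  assumes "z * z = 1"
  shows "path_charpoly (2 * z) n = of_nat (Suc n) * z ^ n"
proof (induction "2 * z" n rule: path_charpoly.induct)
  case (3 n)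
  have "path_charpoly (2 * z) (Suc (Suc n))
      = 2 * of_nat (Suc (Suc n)) * (z * z) * z ^ n - of_nat (Suc n) * z ^ n"
    using 3 by (simp only: path_charpoly.simps power_Suc mult_ac)
  also have "\<dots> = of_nat (Suc (Suc (Suc n))) * (z * z) * z ^ n"
    unfolding assms by (simp add: algebra_simps)
  finally show ?case by (simp only: power_Suc mult_ac)
qed simp_all

text \<open>
  Write \<open>c = z + 1 / z\<close>. By the closed forms a zero \<open>c\<close> has \<open>z \<noteq> 1 / z\<close> and \<open>z^(n + 1) = z^-(n + 1)\<close>,
  so \<open>z\<close> is a \<open>2(n + 1)\<close>-th root of unity other than \<open>\<plusminus>1\<close>, and \<open>c\<close> is twice its real part.
\<close>

lemma path_charpoly_root:
  assumes "path_charpoly c n = 0"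
  obtains t where "t \<in> {1..n}" "c = of_real (2 * cos (pi * real t / real (Suc n)))"
proof -
  let ?N = "Suc n"
  define z where "z = (c + csqrt (c\<^sup>2 - 4)) / 2"
  define y where "y = (c - csqrt (c\<^sup>2 - 4)) / 2"
  have "(c + csqrt (c\<^sup>2 - 4)) * (c - csqrt (c\<^sup>2 - 4)) = c\<^sup>2 - (csqrt (c\<^sup>2 - 4))\<^sup>2"
    by (simp add: algebra_simps power2_eq_square)
  then have zy: "z * y = 1" by (simp add: z_def y_def)
  have c: "c = z + y" by (simp add: z_def y_def field_simps)
  have "z \<noteq> 0" using zy by auto
  have y: "y = inverse z" using zy by (simp add: inverse_unique)
  have "z \<noteq> y"
  proof
    assume "z = y"
    then have "path_charpoly c n = of_nat (Suc n) * z ^ n"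
      using path_charpoly_double[of z n] zy c by simp
    then show False using assms \<open>z \<noteq> 0\<close> by (simp del: of_nat_Suc)
  qed
  have "z ^ ?N = y ^ ?N"
    using path_charpoly_sum_inverse[OF zy, of n] assms c by simp
  then have "z ^ (2 * ?N) = z ^ ?N * y ^ ?N" by (simp only: mult_2 power_add)
  also have "\<dots> = 1" using zy by (metis power_mult_distrib power_one)
  finally have "z ^ (2 * ?N) = 1" .
  moreover have N2: "2 * ?N > 0" by simp
  ultimately have "z \<in> (\<lambda>s. cis (2 * pi * real s / real (2 * ?N))) ` {..<2 * ?N}"
    using bij_betw_imp_surj_on[OF Complex.bij_betw_roots_unity[OF N2]] by blast
  then obtain s where s: "s < 2 * ?N" "z = cis (2 * pi * real s / real (2 * ?N))"
    by blast
  define \<phi> where "\<phi> = pi * real s / real ?N"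
  have \<phi>: "z = cis \<phi>" 
  proof -
    have "2 * pi * real s / real (2 * ?N) = \<phi>" by (simp add: \<phi>_def field_simps)
    then show ?thesis using s(2) by simp
  qed
  have y': "y = cis (- \<phi>)" using y \<phi> by (simp add: cis_inverse)
  have c': "c = of_real (2 * cos \<phi>)" by (simp add: c \<phi> y' complex_eq_iff)
  have "s \<noteq> 0"
  proof
    assume "s = 0"
    then have "\<phi> = 0" by (simp add: \<phi>_def)
    then show False using \<open>z \<noteq> y\<close> by (simp add: \<phi> y')
  qed
  have "s \<noteq> ?N"
  proof
    assume "s = ?N"
    then have "\<phi> = pi" by (simp add: \<phi>_def del: of_nat_Suc)
    then show False using \<open>z \<noteq> y\<close> by (simp add: \<phi> y' complex_eq_iff)
  qed
  show ?thesis
  \<comment> \<open>Conjugating \<open>z\<close> leaves \<open>c\<close> unchanged, so the lower half of the unit circle is redundant.\<close>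
  proof (cases "s < ?N")
    case True
    then show ?thesis using that[of s] c' \<open>s \<noteq> 0\<close> by (simp add: \<phi>_def)
  next
    case False
    have "cos (pi * real (2 * ?N - s) / real ?N) = cos (2 * pi - \<phi>)"
    proof -
      have "real (2 * ?N - s) = 2 * real ?N - real s"
        using s(1) by (simp only: of_nat_diff less_imp_le of_nat_mult of_nat_numeral)
      then have "pi * real (2 * ?N - s) / real ?N = 2 * pi - \<phi>"
        by (simp add: \<phi>_def right_diff_distrib diff_divide_distrib del: of_nat_Suc)
      then show ?thesis by (rule arg_cong)
    qed
    also have "\<dots> = cos \<phi>" by (simp add: cos_diff)
    finally have "c = of_real (2 * cos (pi * real (2 * ?N - s) / real ?N))"
      unfolding c' by (simp only:)
    moreover have "2 * ?N - s \<in> {1..n}" using s(1) False \<open>s \<noteq> ?N\<close> by auto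
    ultimately show ?thesis by (rule that[rotated])
  qed
qed

section \<open>Paths\<close>

text \<open>
  Eliminating the vertex values from the reduced system leaves the recursion \<open>rec\<close> between
  consecutive edge values \<open>r n\<close>. It is nonlinear, but the substitution recorded in the invariant
  \<open>inv\<close>, where vertex values are squares and edge values are products of neighbours, turns it into
  the linear recursion of the path.
\<close>

lemma path_charpoly_zero_of_run:
  fixes r :: "nat \<Rightarrow> complex"
  assumes j: "j \<ge> 1" and c: "c \<noteq> 0"
    and r0: "r 0 = 0" and rj: "r (Suc j) = 0"
    and nz: "\<And>n. 1 \<le> n \<Longrightarrow> n \<le> j \<Longrightarrow> r n \<noteq> 0"
    and rec: "\<And>n. n < j \<Longrightarrow> (r n + r (Suc n)) * (r (Suc n) + r (Suc (Suc n))) = c\<^sup>2 * (r (Suc n))\<^sup>2"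
  shows "path_charpoly c (Suc j) = 0"
proof -
  let ?w = "path_charpoly c"
  have inv: "r (Suc n) * c = r 1 * ?w n * ?w (Suc n) \<and> r n + r (Suc n) = r 1 * (?w n)\<^sup>2"
    if "n \<le> j" for n
    using that
  proof (induction n)
    case 0
    then show ?case using r0 by simp
  next
    case (Suc n)
    then have IH: "r (Suc n) * c = r 1 * ?w n * ?w (Suc n)" "r n + r (Suc n) = r 1 * (?w n)\<^sup>2"
      and n: "n < j" by auto
    have r1: "r 1 \<noteq> 0" using nz j by simp
    have wn: "?w n \<noteq> 0" using IH(1) nz[of "Suc n"] n c by auto
    have "r 1 * (?w n)\<^sup>2 * (r (Suc n) + r (Suc (Suc n))) = (r (Suc n) * c)\<^sup>2"
      using rec[OF n] IH(2) by (simp add: power_mult_distrib mult.commute)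
    also have "\<dots> = r 1 * (?w n)\<^sup>2 * (r 1 * (?w (Suc n))\<^sup>2)"
      unfolding IH(1) by (simp add: power2_eq_square)
    finally have eq: "r (Suc n) + r (Suc (Suc n)) = r 1 * (?w (Suc n))\<^sup>2"
      using r1 wn by simp
    then have "r (Suc (Suc n)) * c = c * (r 1 * (?w (Suc n))\<^sup>2) - r (Suc n) * c"
      unfolding eq[symmetric] by (simp add: algebra_simps)
    also have "\<dots> = r 1 * ?w (Suc n) * ?w (Suc (Suc n))"
      unfolding IH(1) by (simp add: algebra_simps power2_eq_square)
    finally show ?case using eq by simp
  qed
  have "r 1 \<noteq> 0" "r j \<noteq> 0" using nz j by auto
  then show ?thesis using inv[of j] rj by auto
qed

lemma uniform_path_graph: "uniform_hypergraph 2 (path_graph m)"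
  by (auto simp: uniform_hypergraph_def path_graph_def)

lemma path_edge_eq_iff: "{i, Suc i} = {j, Suc j} \<longleftrightarrow> i = j"
  by (auto simp: doubleton_eq_iff)

text \<open>
  The contribution of the edge that ends at vertex \<open>n\<close>, padded by zero beyond both ends of the path
  so that end vertices need no separate treatment.
\<close>

definition edge_into :: "nat \<Rightarrow> (nat set \<Rightarrow> 'b::comm_monoid_add) \<Rightarrow> nat \<Rightarrow> 'b" where
  "edge_into m p n = (case n of 0 \<Rightarrow> 0 | Suc i \<Rightarrow> if i < m then p {i, Suc i} else 0)"

lemma edge_sum_path_graph:
  "(\<Sum>e | e \<in> snd (path_graph m) \<and> u \<in> e. p e) = edge_into m p u + edge_into m p (Suc u)"
proof -
  let ?q = "edge_into m p"
  have "{e. e \<in> snd (path_graph m) \<and> u \<in> e} = (\<lambda>i. {i, Suc i}) ` {i. i < m \<and> (u = i \<or> u = Suc i)}"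
    by (auto simp: path_graph_def)
  then have "(\<Sum>e | e \<in> snd (path_graph m) \<and> u \<in> e. p e)
      = (\<Sum>i | i < m \<and> (u = i \<or> u = Suc i). p {i, Suc i})"
    by (simp add: sum.reindex inj_on_def path_edge_eq_iff)
  also have "\<dots> = (\<Sum>i | i < m \<and> Suc i = u. p {i, Suc i}) + (\<Sum>i | i < m \<and> i = u. p {i, Suc i})"
    by (subst sum.union_disjoint[symmetric]) (auto intro!: sum.cong)
  also have "(\<Sum>i | i < m \<and> i = u. p {i, Suc i}) = ?q (Suc u)"
  proof -
    have "{i. i < m \<and> i = u} = (if u < m then {u} else {})" by auto
    then show ?thesis by (simp add: edge_into_def)
  qed
  also have "(\<Sum>i | i < m \<and> Suc i = u. p {i, Suc i}) = ?q u"
  proof (cases u)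
    case (Suc i)
    then have "{i. i < m \<and> Suc i = u} = (if i < m then {i} else {})" by auto
    then show ?thesis using Suc by (simp add: edge_into_def)
  qed (simp add: edge_into_def)
  finally show ?thesis .
qed

text \<open>
  The least index with nonzero edge value starts a run, and the first zero after it ends the run;
  the zero padding guarantees that it ends within the path, whence \<open>j \<le> m\<close>.
\<close>

lemma hyperpath_eigenvalueD:
  assumes k: "k \<ge> 2" and \<mu>: "\<mu> \<noteq> 0" and ev: "hypergraph_eigenvalue k (hyperpath m k) \<mu>"
  obtains j t where "j \<in> {1..m}" "t \<in> {1..j + 1}"
    "\<mu> ^ k = of_real ((2 * cos (pi * real t / real (j + 2)))\<^sup>2)"
proof -
  obtain X p where nz: "\<exists>e\<in>snd (path_graph m). p e \<noteq> 0"
    and vertex: "\<And>u. u \<in> fst (path_graph m) \<Longrightarrow> (\<Sum>e | e \<in> snd (path_graph m) \<and> u \<in> e. p e) = \<mu> * X u"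
    and edge: "\<And>e. e \<in> snd (path_graph m) \<Longrightarrow> p e \<noteq> 0 \<Longrightarrow> (p e)\<^sup>2 * \<mu> ^ (k - 2) = (\<Prod>u\<in>e. X u)"
    by (rule power_hypergraph_eigenvalueD[OF uniform_path_graph k \<mu> ev[unfolded hyperpath_def]]) blast
  define q where "q = edge_into m p"
  have q: "q u + q (Suc u) = \<mu> * X u" if "u \<le> m" for u
    using vertex[of u] that edge_sum_path_graph[of p m u] by (simp add: q_def path_graph_def)
  have q0: "q 0 = 0" by (simp add: q_def edge_into_def)
  have rec: "(q n + q (Suc n)) * (q (Suc n) + q (Suc (Suc n))) = \<mu> ^ k * (q (Suc n))\<^sup>2"
    if "q (Suc n) \<noteq> 0" for n
  proof -
    have n: "n < m" and p: "p {n, Suc n} = q (Suc n)" using that by (auto simp: q_def edge_into_def split: if_splits)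
    have "(q (Suc n))\<^sup>2 * \<mu> ^ (k - 2) = X n * X (Suc n)"
      using edge[of "{n, Suc n}"] n that p by (auto simp: path_graph_def)
    moreover have "\<mu> ^ k = \<mu>\<^sup>2 * \<mu> ^ (k - 2)" using k by (rule power_extract_square)
    moreover have "(q n + q (Suc n)) * (q (Suc n) + q (Suc (Suc n))) = \<mu>\<^sup>2 * (X n * X (Suc n))"
      using q[of n] q[of "Suc n"] n by (simp add: power2_eq_square)
    ultimately show ?thesis by (simp add: mult_ac)
  qed
  have ex: "\<exists>n. q n \<noteq> 0"
  proof -
    obtain i where "i < m" "p {i, Suc i} \<noteq> 0" using nz by (auto simp: path_graph_def)
    then have "q (Suc i) \<noteq> 0" by (simp add: q_def edge_into_def)
    then show ?thesis ..
  qed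
  define b where "b = (LEAST n. q n \<noteq> 0)"
  have qb: "q b \<noteq> 0" unfolding b_def using ex by (rule LeastI_ex)
  then obtain a where a: "b = Suc a" using q0 by (cases b) auto
  have qa: "q a = 0" using not_less_Least[of a "\<lambda>n. q n \<noteq> 0"] a unfolding b_def by simp
  have am: "a < m" using qb a by (auto simp: q_def edge_into_def split: if_splits)
  have end': "q (a + Suc (m - a)) = 0" using am by (simp add: q_def edge_into_def)
  define j where "j = (LEAST j. q (a + Suc j) = 0)"
  have rj: "q (a + Suc j) = 0" unfolding j_def using end' by (rule LeastI)
  have jm: "j \<le> m - a" unfolding j_def using end' by (rule Least_le)
  have rnz: "q (a + n) \<noteq> 0" if "1 \<le> n" "n \<le> j" for n
    using not_less_Least[of "n - 1" "\<lambda>j. q (a + Suc j) = 0"] that unfolding j_def[symmetric] by auto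
  have j1: "j \<ge> 1" using rj qb a by (cases j) auto
  define c where "c = csqrt (\<mu> ^ k)"
  have c2: "c\<^sup>2 = \<mu> ^ k" by (simp add: c_def)
  have "path_charpoly c (Suc j) = 0"
  proof (rule path_charpoly_zero_of_run[where r = "\<lambda>n. q (a + n)", OF j1])
    show "c \<noteq> 0" using \<mu> by (simp add: c_def)
    show "q (a + 0) = 0" "q (a + Suc j) = 0" using qa rj by auto
    show "q (a + n) \<noteq> 0" if "1 \<le> n" "n \<le> j" for n using rnz that .
    show "(q (a + n) + q (a + Suc n)) * (q (a + Suc n) + q (a + Suc (Suc n))) = c\<^sup>2 * (q (a + Suc n))\<^sup>2"
      if "n < j" for n
      using rec[of "a + n"] rnz[of "Suc n"] that by (simp add: c2)
  qed
  then obtain t where "t \<in> {1..Suc j}" "c = of_real (2 * cos (pi * real t / real (Suc (Suc j))))"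
    by (rule path_charpoly_root)
  then show ?thesis
    using that[of j t] j1 jm am c2 by (simp flip: of_real_power)
qed

text \<open>
  The vector \<open>w\<close> is the eigenvector of the path with \<open>j\<close> edges for the eigenvalue \<open>c\<close>, extended by
  zero. The next sine value after vertex \<open>j\<close> is \<open>sin (\<pi> t) = 0\<close>, so the extension satisfies the recursion
  multiplied by \<open>w\<close> at every vertex, which is all that the reduced system asks for.
\<close>

lemma hyperpath_eigenvalueI:
  assumes k: "k \<ge> 3" and \<mu>: "\<mu> \<noteq> 0" and j: "j \<in> {1..m}" and t: "t \<in> {1..j + 1}"
    and eq: "\<mu> ^ k = of_real ((2 * cos (pi * real t / real (j + 2)))\<^sup>2)"
  shows "hypergraph_eigenvalue k (hyperpath m k) \<mu>"
proof -
  define \<phi> where "\<phi> = pi * real t / real (j + 2)"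
  define c where "c = complex_of_real (2 * cos \<phi>)"
  define w where "w n = (if n \<le> j then complex_of_real (sin (real (Suc n) * \<phi>)) else 0)" for n
  have c2: "c\<^sup>2 = \<mu> ^ k" using eq by (simp add: c_def \<phi>_def)
  have c0: "c \<noteq> 0" using c2 \<mu> by auto
  have end': "sin (real (Suc (Suc j)) * \<phi>) = 0"
  proof -
    have "real (Suc (Suc j)) * \<phi> = pi * real t" by (simp add: \<phi>_def field_simps)
    then show ?thesis by (simp add: sin_zero_iff_int2)
  qed
  have sin_rec: "sin ((x + 1) * \<phi>) + sin ((x - 1) * \<phi>) = 2 * cos \<phi> * sin (x * \<phi>)" for x
    by (simp add: algebra_simps sin_add sin_diff)
  have w0: "c * w 0 = w 1"
    using j sin_double[of \<phi>] by (simp add: w_def c_def)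
  have wrec: "w (Suc n) * (w n + w (Suc (Suc n))) = c * (w (Suc n))\<^sup>2" for n
  proof (cases "Suc n \<le> j")
    case True
    have "w (Suc (Suc n)) = of_real (sin (real (Suc (Suc (Suc n))) * \<phi>))"
    proof (cases "Suc (Suc n) \<le> j")
      case False
      then have "Suc (Suc n) = Suc j" using True by simp
      then show ?thesis using end' by (simp add: w_def)
    qed (simp add: w_def)
    then have "w n + w (Suc (Suc n)) = c * w (Suc n)"
      using True sin_rec[of "real (Suc (Suc n))"]
      by (simp add: w_def c_def add.commute flip: of_real_add of_real_mult)
    then show ?thesis by (simp add: power2_eq_square)
  qed (simp add: w_def)
  have wm: "w (Suc m) = 0" using j by (simp add: w_def)
  have "real t / real (j + 2) < 1" using t by simp
  then have "\<phi> < pi" using mult_strict_left_mono[OF _ pi_gt_zero, of "real t / real (j + 2)" 1]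
    by (simp add: \<phi>_def)
  moreover have "0 < \<phi>" using t by (simp add: \<phi>_def)
  ultimately have wnz: "w 0 \<noteq> 0" using sin_gt_zero[of \<phi>] by (simp add: w_def)
  define X where "X u = (w u)\<^sup>2" for u
  \<comment> \<open>The factor \<open>\<mu> / c\<close> is forced by the vertex equations, as the products at \<open>u\<close> sum to \<open>c (w u)\<^sup>2\<close>.\<close>
  define p where "p e = \<mu> / c * (\<Prod>u\<in>e. w u)" for e :: "nat set"
  have pe: "p {i, Suc i} = \<mu> / c * (w i * w (Suc i))" for i by (simp add: p_def)
  show ?thesis
    unfolding hyperpath_def
  proof (rule power_hypergraph_eigenvalueI[where X = X and p = p, OF uniform_path_graph k \<mu>])
    show "\<exists>u\<in>fst (path_graph m). X u \<noteq> 0"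
      using wnz by (auto simp: path_graph_def X_def)
  next
    fix u assume "u \<in> fst (path_graph m)"
    then have u: "u \<le> m" by (simp add: path_graph_def)
    have out: "edge_into m p (Suc u) = \<mu> / c * (w u * w (Suc u))"
      using u wm by (cases "u = m") (auto simp: edge_into_def pe)
    show "(\<Sum>e | e \<in> snd (path_graph m) \<and> u \<in> e. p e) = \<mu> * X u"
    proof (cases u)
      case 0
      have "(\<Sum>e | e \<in> snd (path_graph m) \<and> u \<in> e. p e) = \<mu> / c * (w 0 * (c * w 0))"
        unfolding edge_sum_path_graph w0 out by (simp add: 0 edge_into_def)
      then show ?thesis using c0 0 by (simp add: X_def power2_eq_square)
    next
      case (Suc i)
      have "(\<Sum>e | e \<in> snd (path_graph m) \<and> u \<in> e. p e)
          = \<mu> / c * (w i * w u) + \<mu> / c * (w u * w (Suc u))"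
        unfolding edge_sum_path_graph out using Suc u by (simp add: edge_into_def pe)
      also have "\<dots> = \<mu> / c * (w u * (w i + w (Suc u)))" by (simp add: algebra_simps)
      also have "\<dots> = \<mu> * X u" using wrec[of i] c0 by (simp add: Suc X_def)
      finally show ?thesis .
    qed
  next
    fix e assume "e \<in> snd (path_graph m)"
    have "(p e)\<^sup>2 * \<mu> ^ (k - 2) = (\<mu>\<^sup>2 * \<mu> ^ (k - 2)) / c\<^sup>2 * (\<Prod>u\<in>e. w u)\<^sup>2"
      by (simp add: p_def power_mult_distrib power_divide)
    also have "\<mu>\<^sup>2 * \<mu> ^ (k - 2) = c\<^sup>2" using power_extract_square[of k \<mu>] k by (simp add: c2)
    finally show "(p e)\<^sup>2 * \<mu> ^ (k - 2) = (\<Prod>u\<in>e. X u)"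
      using c0 by (simp add: X_def prod_power_distrib)
  qed
qed

text \<open>
  For a vector supported on a single vertex, each product in the equations has \<open>k - 1 \<ge> 2\<close> factors,
  hence a vanishing one.
\<close>

lemma hyperpath_eigenvalue_zero:
  assumes "k \<ge> 3"
  shows "hypergraph_eigenvalue k (hyperpath m k) 0"
proof -
  let ?H = "hyperpath m k"
  define x :: "nat + nat set \<times> nat \<Rightarrow> complex" where "x v = (if v = Inl 0 then 1 else 0)" for v
  have "(\<Prod>l\<in>e - {v}. x l) = 0" if e: "e \<in> snd ?H" for e v
  proof -
    have card: "card e = k"
      using uniform_hypergraph_hyperpath[of k m] assms e unfolding uniform_hypergraph_def by simp
    then have fin: "finite e" using assms by (intro card_ge_0_finite) simp
    have "\<not> e \<subseteq> {v, Inl 0}"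
    proof
      assume "e \<subseteq> {v, Inl 0}"
      then have "card e \<le> card {v, Inl 0}" by (intro card_mono) auto
      also have "\<dots> \<le> 2" by (simp add: card_insert_if)
      finally show False using card assms by simp
    qed
    then have "\<exists>l\<in>e - {v}. x l = 0" by (auto simp: x_def)
    then show ?thesis using fin by (simp add: prod_zero)
  qed
  moreover have "Inl 0 \<in> fst ?H" by (simp add: hyperpath_def power_hypergraph_def path_graph_def)
  ultimately show ?thesis
    unfolding hypergraph_eigenvalue_def by (intro exI[of _ x]) (auto simp: x_def)
qed

section \<open>The spectrum\<close>

lemma power_eq_iff_root_of_unity_multiple:
  fixes a \<mu> :: complex
  assumes "n > 0"
  shows "\<mu> ^ n = a ^ n \<longleftrightarrow> (\<exists>\<theta>\<in>{1..n}. \<mu> = a * exp (\<i> * of_real (2 * pi / real n * real \<theta>)))"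
proof -
  have e: "exp (\<i> * of_real (2 * pi / real n * real \<theta>)) = cis (2 * pi * real \<theta> / real n)" for \<theta>
    by (simp add: cis_conv_exp)
  have one: "cis (2 * pi * real \<theta> / real n) ^ n = 1" for \<theta>
  proof -
    have "real n * (2 * pi * real \<theta> / real n) = 2 * pi * real \<theta>" using assms by simp
    then show ?thesis using cis_multiple_2pi[of "real \<theta>"] by (simp only: Complex.DeMoivre Ints_of_nat)
  qed
  show ?thesis
    unfolding e
  proof
    assume eq: "\<mu> ^ n = a ^ n"
    show "\<exists>\<theta>\<in>{1..n}. \<mu> = a * cis (2 * pi * real \<theta> / real n)"
    proof (cases "a = 0")
      case True
      then have "\<mu> ^ n = 0" using eq assms by (simp add: zero_power)
      then show ?thesis using True assms by (auto intro!: bexI[of _ 1])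
    next
      case False
      then have "(\<mu> / a) ^ n = 1" using eq by (simp add: power_divide)
      then have "\<mu> / a \<in> (\<lambda>s. cis (2 * pi * real s / real n)) ` {..<n}"
        by (subst bij_betw_imp_surj_on[OF Complex.bij_betw_roots_unity[OF assms]]) simp
      then obtain s where s: "s < n" "\<mu> / a = cis (2 * pi * real s / real n)"
        by blast
      show ?thesis
      proof (cases "s = 0")
        case True
        then have "\<mu> = a" using s(2) False by (simp add: divide_eq_1_iff)
        then show ?thesis using assms by (intro bexI[of _ n]) auto
      next
        case ne: False
        then show ?thesis using s False by (intro bexI[of _ s]) (auto simp: field_simps)
      qed
    qed
  next
    assume "\<exists>\<theta>\<in>{1..n}. \<mu> = a * cis (2 * pi * real \<theta> / real n)"
    then show "\<mu> ^ n = a ^ n" using one by (auto simp: power_mult_distrib)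
  qed
qed

theorem theorem3p5:
  fixes m k :: nat and pow2k :: "real \<Rightarrow> complex"
  assumes "m \<ge> 2" and "k \<ge> 3"
    and pow2k: "\<And>c. pow2k c ^ k = complex_of_real (c\<^sup>2)"
  shows "{\<mu>. hypergraph_eigenvalue k (hyperpath m k) \<mu>} =
    {pow2k (2 * cos (pi / real (j + 2) * real t)) * exp (\<i> * of_real (2 * pi / real k * real \<theta>)) |
       j t \<theta>. j \<in> {1..m} \<and> t \<in> {1..j + 1} \<and> \<theta> \<in> {1..k}}"
    (is "?S = ?T")
proof -
  have "k > 0" using assms(2) by simp
  have T: "\<mu> \<in> ?T \<longleftrightarrow> (\<exists>j\<in>{1..m}. \<exists>t\<in>{1..j + 1}.
      \<mu> ^ k = of_real ((2 * cos (pi * real t / real (j + 2)))\<^sup>2))" (is "_ \<longleftrightarrow> ?R \<mu>") for \<mu>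
  proof -
    have "\<mu> \<in> ?T \<longleftrightarrow> (\<exists>j\<in>{1..m}. \<exists>t\<in>{1..j + 1}.
        \<mu> ^ k = pow2k (2 * cos (pi / real (j + 2) * real t)) ^ k)"
      unfolding power_eq_iff_root_of_unity_multiple[OF \<open>k > 0\<close>] by blast
    then show ?thesis by (simp only: pow2k times_divide_eq_left)
  qed
  have "hypergraph_eigenvalue k (hyperpath m k) \<mu> \<longleftrightarrow> ?R \<mu>" for \<mu>
  proof (cases "\<mu> = 0")
    case True
    have "?R 0"
      using assms by (intro bexI[of _ 2] bexI[of _ "2::nat"]) auto
    then show ?thesis using True hyperpath_eigenvalue_zero[OF assms(2)] by blast
  next
    case False
    then show ?thesis
      using hyperpath_eigenvalueD[of k \<mu> m ?thesis] hyperpath_eigenvalueI[of k \<mu> _ m] assms(2)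
      by fastforce
  qed
  then show ?thesis using T by blast
qed

end
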